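(* Let $k$ be a positive integer, let $\mathcal{A}$ be a monotone family of subsets of $[n]$ with all minterms of size at most $k$, and let $p\in[0,1]$. Then for any $\alpha>0$, $$\mathbb{E}^*_p(\mathcal{A})\ \ge\ \mu_p(\mathcal{A})\ \ge\ \mathbb{E}^*_{\alpha p}(\mathcal{A})\,(1+\alpha)^{-k}.$$
   Context: Let $[n]=\{0,1,\ldots,n\}$ and let $P([n])$ be its power set. For $p\in[0,1]$, $\mu_p(\mathcal{A})$ is the probability that a random subset of $[n]$, containing each element independently with probability $p$, belongs to $\mathcal{A}\subseteq P([n])$. A family $\mathcal{A}$ is monotone if $A\in\mathcal{A}$ and $A\subset B\subseteq [n]$ imply $B\in\mathcal{A}$. A minterm of $\mathcal{A}$ is a member of $\mathcal{A}$ minimal with respect to inclusion; let $\mathcal{M}$ be the set of minterms of $\mathcal{A}$. For real $q\ge 0$ the fractional expectation of $\mathcal{A}$ is $$\mathbb{E}^*_q(\mathcal{A})=\min \sum_{B\subseteq[n]}\beta(B)\,q^{|B|},$$ where the minimum is over all functions $\beta:P([n])\to\mathbb{R}^{\ge 0}$ such that $\sum_{B\subseteq A}\beta(B)\ge 1$ for all $A\in\mathcal{M}$. (The empty set is allowed as $B$; $q^0=1$.) *)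

theory Defs
  imports "HOL-Probability.Probability"
begin

definition random_subset_pmf :: "nat \<Rightarrow> real \<Rightarrow> nat set pmf" where
  "random_subset_pmf n p =
     map_pmf (\<lambda>f. {i \<in> {0..n}. f i}) (Pi_pmf {0..n} False (\<lambda>_. bernoulli_pmf p))"

definition mu :: "nat \<Rightarrow> real \<Rightarrow> nat set set \<Rightarrow> real" where
  "mu n p \<A> = measure_pmf.prob (random_subset_pmf n p) \<A>"

definition monotone_family :: "nat \<Rightarrow> nat set set \<Rightarrow> bool" where
  "monotone_family n \<A> \<longleftrightarrow>
     \<A> \<subseteq> Pow {0..n} \<and> (\<forall>A B. A \<in> \<A> \<and> A \<subseteq> B \<and> B \<subseteq> {0..n} \<longrightarrow> B \<in> \<A>)"

definition minterms :: "nat set set \<Rightarrow> nat set set" where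
  "minterms \<A> = {A \<in> \<A>. \<forall>B \<in> \<A>. B \<subseteq> A \<longrightarrow> B = A}"

definition fractional_covers :: "nat \<Rightarrow> nat set set \<Rightarrow> (nat set \<Rightarrow> real) set" where
  "fractional_covers n \<A> =
     {\<beta>. (\<forall>B \<in> Pow {0..n}. 0 \<le> \<beta> B) \<and> (\<forall>A \<in> minterms \<A>. (\<Sum>B \<in> Pow A. \<beta> B) \<ge> 1)}"

definition cover_weight :: "nat \<Rightarrow> real \<Rightarrow> (nat set \<Rightarrow> real) \<Rightarrow> real" where
  "cover_weight n q \<beta> = (\<Sum>B \<in> Pow {0..n}. \<beta> B * q ^ card B)"

text \<open>The infimum is in fact a minimum for q \<open>\<ge> 0\<close>; see \<open>frac_expectation_is_min\<close> below.\<close>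

definition frac_expectation :: "nat \<Rightarrow> real \<Rightarrow> nat set set \<Rightarrow> real" where
  "frac_expectation n q \<A> = (INF \<beta> \<in> fractional_covers n \<A>. cover_weight n q \<beta>)"

lemma frac_expectation_is_min:
  assumes "\<A> \<subseteq> Pow {0..n}" and "q \<ge> 0"
  shows "\<exists>\<beta> \<in> fractional_covers n \<A>. frac_expectation n q \<A> = cover_weight n q \<beta> \<and>
           (\<forall>\<gamma> \<in> fractional_covers n \<A>. cover_weight n q \<beta> \<le> cover_weight n q \<gamma>)"
proof -
  let ?C = "fractional_covers n \<A>"
  let ?w = "cover_weight n q"
  define box where "box = (UNIV \<rightarrow>\<^sub>E {0..1} :: (nat set \<Rightarrow> real) set)"
  define K where "K = box \<inter> (\<Inter>A \<in> minterms \<A>. {\<beta>. (\<Sum>B \<in> Pow A. \<beta> B) \<ge> 1})"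
  have sub: "A \<subseteq> {0..n}" if "A \<in> minterms \<A>" for A
    using that assms(1) by (auto simp: minterms_def)
  have "compactin (product_topology (\<lambda>_. euclidean) UNIV) box"
    unfolding box_def by (subst compactin_PiE) auto
  then have "compact box"
    by (simp add: euclidean_product_topology flip: compactin_euclidean_iff)
  moreover have "closed (\<Inter>A \<in> minterms \<A>. {\<beta> :: nat set \<Rightarrow> real. (\<Sum>B \<in> Pow A. \<beta> B) \<ge> 1})"
    by (intro closed_INT ballI closed_Collect_le continuous_intros continuous_on_product_coordinates)
  ultimately have "compact K"
    unfolding K_def by (rule compact_Int_closed)
  have trunc: "(\<lambda>B. if B \<subseteq> {0..n} then min 1 (\<gamma> B) else 0) \<in> K \<and>
      ?w (\<lambda>B. if B \<subseteq> {0..n} then min 1 (\<gamma> B) else 0) \<le> ?w \<gamma>" if g: "\<gamma> \<in> ?C" for \<gamma>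
  proof -
    let ?t = "\<lambda>B. if B \<subseteq> {0..n} then min 1 (\<gamma> B) else 0"
    have pos: "0 \<le> \<gamma> B" if "B \<subseteq> {0..n}" for B
      using g that by (auto simp: fractional_covers_def)
    have "(\<Sum>B \<in> Pow A. ?t B) \<ge> 1" if A: "A \<in> minterms \<A>" for A
    proof (cases "\<exists>B \<in> Pow A. \<gamma> B \<ge> 1")
      case True
      then obtain B where B: "B \<in> Pow A" "\<gamma> B \<ge> 1" by blast
      have "finite A" using sub[OF A] finite_subset by blast
      then have "?t B \<le> (\<Sum>B \<in> Pow A. ?t B)"
        using B pos by (intro member_le_sum) auto
      moreover have "?t B = 1" using B sub[OF A] by auto
      ultimately show ?thesis by linarith
    next
      case False
      then have "(\<Sum>B \<in> Pow A. ?t B) = (\<Sum>B \<in> Pow A. \<gamma> B)"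
        using sub[OF A] by (intro sum.cong) (auto simp: min_def)
      then show ?thesis using g A by (auto simp: fractional_covers_def)
    qed
    moreover have "?t \<in> box"
      using pos by (auto simp: box_def)
    ultimately have "?t \<in> K" by (auto simp: K_def)
    moreover have "?w ?t \<le> ?w \<gamma>"
      unfolding cover_weight_def using assms(2)
      by (intro sum_mono mult_right_mono) auto
    ultimately show ?thesis by blast
  qed
  have KC: "K \<subseteq> ?C"
    by (auto simp: K_def box_def fractional_covers_def PiE_iff)
  have "(\<lambda>_. 1) \<in> ?C"
  proof -
    have "(\<Sum>B \<in> Pow A. 1 :: real) \<ge> 1" if "A \<in> minterms \<A>" for A
      using finite_subset[OF sub[OF that]] by (simp add: card_Pow)
    then show ?thesis by (simp add: fractional_covers_def)
  qed
  with trunc have "K \<noteq> {}" by blast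
  moreover have "continuous_on K ?w"
    unfolding cover_weight_def
    by (intro continuous_intros continuous_on_subset[OF continuous_on_product_coordinates subset_UNIV])
  ultimately obtain \<beta> where b: "\<beta> \<in> K" "\<forall>\<gamma> \<in> K. ?w \<beta> \<le> ?w \<gamma>"
    using continuous_attains_inf[OF \<open>compact K\<close>] by blast
  have min: "\<forall>\<gamma> \<in> ?C. ?w \<beta> \<le> ?w \<gamma>"
    using b trunc by (meson order_trans)
  have "frac_expectation n q \<A> = ?w \<beta>"
    unfolding frac_expectation_def
    using b KC min by (intro cInf_eq_minimum) auto
  with b KC min show ?thesis by blast
qed

end

theory Submission
  imports Defs
begin

text \<open>
  The first inequality is a union bound. For the second, take for \<open>W \<in> \<A>\<close> the first minterm
  \<open>M W\<close> contained in \<open>W\<close>, in some fixed order of the minterms, and let \<open>x A'\<close> be the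
  probability that the random set \<open>W\<close> is in \<open>\<A>\<close> and \<open>M W = A'\<close>. Let
  \<open>\<beta> B = (1/p - 1) ^ card B * (\<Sum>A' \<supseteq> B. x A')\<close>. By the binomial theorem the sum of \<open>\<beta>\<close> over
  the subsets of a minterm \<open>A\<close> is \<open>\<Sum>A'. x A' / p ^ card (A \<inter> A')\<close>. Here \<open>x A' / p ^ card (A \<inter> A')\<close>
  is the probability that \<open>M (W \<union> (A \<inter> A')) = A'\<close>, which is at least the probability that
  \<open>M (W \<union> A) = A'\<close>, and the latter probabilities add up to 1. So \<open>\<beta>\<close> is a fractional cover, and,
  again by the binomial theorem, its weight at \<open>\<alpha> * p\<close> is
  \<open>\<Sum>A'. x A' * (1 + \<alpha> * (1 - p)) ^ card A' \<le> (1 + \<alpha>) ^ k * \<mu>\<close>.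
\<close>

section \<open>Expectation over a random subset\<close>

text \<open>An explicit finite sum over an arbitrary ground set, so that elements of
  \<open>V\<close> can be split off one at a time.\<close>

definition subset_expectation :: "'a set \<Rightarrow> real \<Rightarrow> ('a set \<Rightarrow> real) \<Rightarrow> real" where
  "subset_expectation V p f = (\<Sum>W \<in> Pow V. p ^ card W * (1 - p) ^ card (V - W) * f W)"

text \<open>Binomial theorem: expand a product of \<open>card V\<close> factors
  \<open>a + 1\<close>, where \<open>W\<close> records the factors contributing
  \<open>a\<close>.\<close>

lemma sum_Pow_power_card:
  fixes a :: "'b::comm_semiring_1"
  assumes "finite V"
  shows "(\<Sum>W \<in> Pow V. a ^ card W) = (a + 1) ^ card V"
  using prod_add[OF assms, of "\<lambda>_. a" "\<lambda>_. 1"] by simp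

lemma sum_Pow_insert:
  assumes "finite V" "v \<notin> V"
  shows "(\<Sum>W \<in> Pow (insert v V). f W) = (\<Sum>W \<in> Pow V. f W) + (\<Sum>W \<in> Pow V. f (insert v W))"
proof -
  have "inj_on (insert v) (Pow V)"
    using assms(2) by (intro inj_onI) (metis PowD insert_ident subsetD)
  moreover have "Pow V \<inter> insert v ` Pow V = {}"
    using assms(2) by auto
  ultimately show ?thesis
    using assms(1) by (simp add: Pow_insert sum.union_disjoint sum.reindex)
qed

text \<open>Condition on whether \<open>v\<close> belongs to the random set.\<close>

lemma subset_expectation_insert:
  assumes "finite V" "v \<notin> V"
  shows "subset_expectation (insert v V) p f =
    p * subset_expectation V p (\<lambda>W. f (insert v W)) + (1 - p) * subset_expectation V p f"
proof -
  have "card (insert v W) = Suc (card W)" "card (insert v V - W) = Suc (card (V - W))"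
    "insert v V - insert v W = V - W" if "W \<subseteq> V" for W
  proof -
    have "finite W" "v \<notin> W" using that assms finite_subset by auto
    moreover from this have "insert v V - W = insert v (V - W)" by auto
    ultimately show "card (insert v W) = Suc (card W)"
      "card (insert v V - W) = Suc (card (V - W))" "insert v V - insert v W = V - W"
      using assms by auto
  qed
  then show ?thesis
    unfolding subset_expectation_def using assms
    by (simp add: sum_Pow_insert sum_distrib_left mult_ac add.commute)
qed

lemma subset_expectation_one [simp]: "finite V \<Longrightarrow> subset_expectation V p (\<lambda>_. 1) = 1"
  using prod_add[of V "\<lambda>_. p" "\<lambda>_. 1 - p"] by (simp add: subset_expectation_def)

lemma subset_expectation_cong:
  "(\<And>W. W \<subseteq> V \<Longrightarrow> f W = g W) \<Longrightarrow> subset_expectation V p f = subset_expectation V p g"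
  by (auto simp: subset_expectation_def intro: sum.cong)

lemma subset_expectation_mono:
  assumes "p \<in> {0..1}" "\<And>W. W \<subseteq> V \<Longrightarrow> f W \<le> g W"
  shows "subset_expectation V p f \<le> subset_expectation V p g"
  unfolding subset_expectation_def using assms by (intro sum_mono mult_left_mono) auto

lemma subset_expectation_nonneg:
  assumes "p \<in> {0..1}" "\<And>W. W \<subseteq> V \<Longrightarrow> 0 \<le> f W"
  shows "0 \<le> subset_expectation V p f"
  unfolding subset_expectation_def using assms by (intro sum_nonneg mult_nonneg_nonneg) auto

lemma subset_expectation_sum:
  "subset_expectation V p (\<lambda>W. \<Sum>i \<in> I. f i W) = (\<Sum>i \<in> I. subset_expectation V p (f i))"
  unfolding subset_expectation_def sum_distrib_left by (rule sum.swap)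

lemma subset_expectation_cmult:
  "subset_expectation V p (\<lambda>W. c * f W) = c * subset_expectation V p f"
  by (simp add: subset_expectation_def sum_distrib_left mult_ac)

text \<open>Only sets containing \<open>C\<close> contribute. This event has probability
  \<open>p ^ card C\<close>, and conditioning on it amounts to adding \<open>C\<close> to the random
  set. The induction forces in one element of \<open>C\<close> at a time.\<close>

lemma subset_expectation_union:
  assumes "finite V" "C \<subseteq> V" "\<And>W. \<not> C \<subseteq> W \<Longrightarrow> f W = 0"
  shows "subset_expectation V p f = p ^ card C * subset_expectation V p (\<lambda>W. f (W \<union> C))"
proof -
  have "finite C" using assms(1,2) finite_subset by blast
  then show ?thesis
    using assms(2,3)
  proof (induction C arbitrary: f rule: finite_induct)
    case empty
    show ?case by simp
  next
    case (insert v C)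
    define V' where "V' = V - {v}"
    have V: "V = insert v V'" and V': "finite V'" "v \<notin> V'"
      using insert.prems(1) assms(1) by (auto simp: V'_def)
    have "subset_expectation V p f = p * subset_expectation V' p (\<lambda>W. f (insert v W))"
    proof -
      \<comment> \<open>Subsets of \<open>V'\<close> miss \<open>v\<close>, so \<open>f\<close>
        vanishes on them.\<close>
      have "subset_expectation V' p f = subset_expectation V' p (\<lambda>_. 0)"
        using insert.prems(2) V' by (intro subset_expectation_cong) blast
      then show ?thesis
        unfolding V subset_expectation_insert[OF V'] by (simp add: subset_expectation_def)
    qed
    \<comment> \<open>The value of \<open>f (insert v W)\<close> does not depend on whether
      \<open>v\<close> is in \<open>W\<close>, so both branches of the conditioning agree.\<close>
    also have "subset_expectation V' p (\<lambda>W. f (insert v W)) =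
        subset_expectation V p (\<lambda>W. f (insert v W))"
      unfolding V subset_expectation_insert[OF V'] by (simp add: algebra_simps)
    also have "\<dots> = p ^ card C * subset_expectation V p (\<lambda>W. f (insert v (W \<union> C)))"
    proof (rule insert.IH)
      show "C \<subseteq> V" using insert.prems(1) by simp
      fix W assume "\<not> C \<subseteq> W"
      then have "\<not> insert v C \<subseteq> insert v W" using insert.hyps(2) by auto
      then show "f (insert v W) = 0" by (rule insert.prems(2))
    qed
    finally show ?case
      using insert.hyps by simp
  qed
qed

lemma subset_expectation_superset:
  assumes "finite V" "B \<subseteq> V"
  shows "subset_expectation V p (\<lambda>W. of_bool (B \<subseteq> W)) = p ^ card B"
  using assms by (subst subset_expectation_union[of V B]) auto

section \<open>The measure \<open>mu\<close> as a finite sum\<close>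

lemma pmf_random_subset_pmf:
  assumes "p \<in> {0..1}" "W \<subseteq> {0..n}"
  shows "pmf (random_subset_pmf n p) W = p ^ card W * (1 - p) ^ card ({0..n} - W)"
proof -
  let ?P = "Pi_pmf {0..n} False (\<lambda>_. bernoulli_pmf p)"
  have "random_subset_pmf n p = map_pmf Collect ?P"
    unfolding random_subset_pmf_def
  \<comment> \<open>The default value \<open>False\<close> outside \<open>{0..n}\<close> makes the
    restriction to \<open>{0..n}\<close> redundant on the support. It can be replaced by
    \<open>Collect\<close>, which is injective.\<close>
  proof (intro map_pmf_cong refl)
    fix f assume "f \<in> set_pmf ?P"
    then have "f \<in> PiE_dflt {0..n} False (set_pmf \<circ> (\<lambda>_. bernoulli_pmf p))"
      using set_Pi_pmf_subset'[of "{0..n}" False "\<lambda>_. bernoulli_pmf p"] by auto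
    then show "{i \<in> {0..n}. f i} = Collect f"
      by (auto simp: PiE_dflt_def)
  qed
  then have "pmf (random_subset_pmf n p) W = pmf ?P (\<lambda>i. i \<in> W)"
    using pmf_map_inj'[of Collect ?P "\<lambda>i. i \<in> W"] by (simp add: injI[OF Collect_inj])
  also have "\<dots> = (\<Prod>i \<in> {0..n}. pmf (bernoulli_pmf p) (i \<in> W))"
    using assms(2) by (intro pmf_Pi') auto
  also have "\<dots> = (\<Prod>i \<in> {0..n}. if i \<in> W then p else 1 - p)"
    using assms(1) by (intro prod.cong) auto
  also have "\<dots> = p ^ card W * (1 - p) ^ card ({0..n} - W)"
    using assms(2) by (simp add: prod.If_cases Int_absorb1 flip: Diff_eq)
  finally show ?thesis .
qed

lemma mu_eq_subset_expectation:
  assumes "p \<in> {0..1}" "\<A> \<subseteq> Pow {0..n}"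
  shows "mu n p \<A> = subset_expectation {0..n} p (\<lambda>W. of_bool (W \<in> \<A>))"
proof -
  have "finite \<A>" using assms(2) finite_subset by blast
  then have "mu n p \<A> = (\<Sum>W \<in> \<A>. pmf (random_subset_pmf n p) W)"
    by (simp add: mu_def measure_measure_pmf_finite)
  also have "\<dots> = (\<Sum>W \<in> \<A>. p ^ card W * (1 - p) ^ card ({0..n} - W) * of_bool (W \<in> \<A>))"
    using assms by (intro sum.cong) (auto simp: pmf_random_subset_pmf)
  also have "\<dots> = subset_expectation {0..n} p (\<lambda>W. of_bool (W \<in> \<A>))"
    unfolding subset_expectation_def using assms(2) by (intro sum.mono_neutral_left) auto
  finally show ?thesis .
qed

section \<open>Covers, minterms and the upper bound on \<open>mu\<close>\<close>

lemma frac_expectation_le_cover_weight: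
  assumes "\<A> \<subseteq> Pow {0..n}" "q \<ge> 0" "\<beta> \<in> fractional_covers n \<A>"
  shows "frac_expectation n q \<A> \<le> cover_weight n q \<beta>"
  using frac_expectation_is_min[OF assms(1,2)] assms(3) by auto

lemma ex_minterm_subset:
  assumes "\<A> \<subseteq> Pow {0..n}" "W \<in> \<A>"
  obtains A where "A \<in> minterms \<A>" "A \<subseteq> W"
proof -
  have "finite \<A>" using assms(1) finite_subset by blast
  then obtain A where "A \<in> \<A>" "A \<subseteq> W" "\<forall>B \<in> \<A>. B \<subseteq> A \<longrightarrow> A = B"
    using finite_has_minimal2[OF _ assms(2)] by blast
  then have "A \<in> minterms \<A>" by (auto simp: minterms_def)
  then show ?thesis using \<open>A \<subseteq> W\<close> by (rule that)
qed

lemma mu_le_frac_expectation: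
  assumes "\<A> \<subseteq> Pow {0..n}" "p \<in> {0..1}"
  shows "mu n p \<A> \<le> frac_expectation n p \<A>"
proof -
  have "p \<ge> 0" using assms(2) by simp
  then obtain \<beta> where \<beta>: "\<beta> \<in> fractional_covers n \<A>"
    and eq: "frac_expectation n p \<A> = cover_weight n p \<beta>"
    using frac_expectation_is_min[OF assms(1)] by blast
  have pos: "0 \<le> \<beta> B" if "B \<subseteq> {0..n}" for B
    using \<beta> that by (auto simp: fractional_covers_def)
  \<comment> \<open>Pointwise form of the union bound; taking expectations turns each indicator of
    \<open>B \<subseteq> W\<close> into \<open>p ^ card B\<close>.\<close>
  have "of_bool (W \<in> \<A>) \<le> (\<Sum>B \<in> Pow {0..n}. \<beta> B * of_bool (B \<subseteq> W))" if "W \<subseteq> {0..n}" for W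
  proof (cases "W \<in> \<A>")
    case True
    obtain A where A: "A \<in> minterms \<A>" "A \<subseteq> W"
      using ex_minterm_subset[OF assms(1) True] .
    have "1 \<le> (\<Sum>B \<in> Pow A. \<beta> B)"
      using \<beta> A(1) by (auto simp: fractional_covers_def)
    also have "\<dots> = (\<Sum>B \<in> Pow A. \<beta> B * of_bool (B \<subseteq> W))"
      using A(2) by (intro sum.cong) auto
    also have "\<dots> \<le> (\<Sum>B \<in> Pow {0..n}. \<beta> B * of_bool (B \<subseteq> W))"
      using A(2) that pos by (intro sum_mono2) auto
    finally show ?thesis using True by simp
  next
    case False
    then show ?thesis using pos by (auto intro!: sum_nonneg)
  qed
  then have "mu n p \<A> \<le>
      subset_expectation {0..n} p (\<lambda>W. \<Sum>B \<in> Pow {0..n}. \<beta> B * of_bool (B \<subseteq> W))"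
    unfolding mu_eq_subset_expectation[OF assms(2,1)]
    by (intro subset_expectation_mono[OF assms(2)])
  also have "\<dots> = (\<Sum>B \<in> Pow {0..n}. \<beta> B * p ^ card B)"
    unfolding subset_expectation_sum subset_expectation_cmult
    by (intro sum.cong) (auto simp: subset_expectation_superset)
  finally show ?thesis unfolding eq cover_weight_def .
qed

section \<open>The lower bound on \<open>mu\<close> for positive \<open>p\<close>\<close>

text \<open>The last conjunct expresses that the choice is the first admissible one in a fixed order.\<close>

lemma ex_consistent_choice:
  assumes "finite \<F>"
  shows "\<exists>M. (\<forall>A \<in> \<F>. \<forall>W. A \<subseteq> W \<longrightarrow> M W \<in> \<F> \<and> M W \<subseteq> W) \<and>
    (\<forall>A \<in> \<F>. \<forall>U V. M V = A \<longrightarrow> A \<subseteq> U \<longrightarrow> U \<subseteq> V \<longrightarrow> M U = A)"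
proof -
  obtain idx :: "'a set \<Rightarrow> nat" where idx: "inj_on idx \<F>"
    using finite_imp_inj_to_nat_seg[OF assms] by blast
  define M where "M W = arg_min_on idx {A \<in> \<F>. A \<subseteq> W}" for W
  have M: "M W \<in> \<F> \<and> M W \<subseteq> W" and least: "idx (M W) \<le> idx A"
    if "A \<in> \<F>" "A \<subseteq> W" for A W
  proof -
    have fin: "finite {A \<in> \<F>. A \<subseteq> W}" and ne: "{A \<in> \<F>. A \<subseteq> W} \<noteq> {}"
      using that assms by auto
    show "M W \<in> \<F> \<and> M W \<subseteq> W"
      using arg_min_if_finite(1)[OF fin ne, of idx] unfolding M_def by auto
    show "idx (M W) \<le> idx A"
      using arg_min_least[OF fin ne, of A idx] that unfolding M_def by simp
  qed
  have "M U = A" if "A \<in> \<F>" "M V = A" "A \<subseteq> U" "U \<subseteq> V" for A U V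
  proof -
    have "M U \<in> \<F>" "M U \<subseteq> U" using M that by auto
    \<comment> \<open>\<open>M U\<close> is a candidate for \<open>V\<close> and \<open>A\<close> is
      one for \<open>U\<close>, so each index bounds the other.\<close>
    then have "idx A \<le> idx (M U)" "idx (M U) \<le> idx A"
      using least[of "M U" V] least[of A U] that by auto
    then show ?thesis using idx that(1) \<open>M U \<in> \<F>\<close> by (auto dest: inj_onD)
  qed
  then show ?thesis using M by (intro exI[of _ M] conjI[of "Ball _ _"] ballI allI impI)
qed

lemma frac_expectation_le_mu:
  assumes "monotone_family n \<A>" "\<And>A. A \<in> minterms \<A> \<Longrightarrow> card A \<le> k"
    and "p \<in> {0<..1}" "\<alpha> > 0"
  shows "frac_expectation n (\<alpha> * p) \<A> \<le> (1 + \<alpha>) ^ k * mu n p \<A>"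
proof -
  have sub: "\<A> \<subseteq> Pow {0..n}"
    and up: "\<And>A B. A \<in> \<A> \<Longrightarrow> A \<subseteq> B \<Longrightarrow> B \<subseteq> {0..n} \<Longrightarrow> B \<in> \<A>"
    using assms(1) by (auto simp: monotone_family_def)
  have p: "p \<in> {0..1}" "p > 0" using assms(3) by auto
  let ?\<M> = "minterms \<A>"
  let ?E = "subset_expectation {0..n} p"
  have "?\<M> \<subseteq> \<A>" by (auto simp: minterms_def)
  then have \<M>: "A \<in> \<A>" "A \<subseteq> {0..n}" "finite A" if "A \<in> ?\<M>" for A
    using that sub finite_subset[of A "{0..n}"] by auto
  have fin: "finite ?\<M>"
    using \<open>?\<M> \<subseteq> \<A>\<close> sub finite_subset by (metis finite_Pow_iff finite_atLeastAtMost)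
  obtain M where M: "\<forall>A \<in> ?\<M>. \<forall>W. A \<subseteq> W \<longrightarrow> M W \<in> ?\<M> \<and> M W \<subseteq> W"
    and cons: "\<forall>A \<in> ?\<M>. \<forall>U V. M V = A \<longrightarrow> A \<subseteq> U \<longrightarrow> U \<subseteq> V \<longrightarrow> M U = A"
    using ex_consistent_choice[OF fin] by (elim exE conjE)
  have M\<A>: "M W \<in> ?\<M>" "M W \<subseteq> W" if W: "W \<in> \<A>" for W
  proof -
    obtain A where "A \<in> ?\<M>" "A \<subseteq> W" using ex_minterm_subset[OF sub W] .
    then show "M W \<in> ?\<M>" "M W \<subseteq> W" using M by blast+
  qed
  define x where "x A = ?E (\<lambda>W. of_bool (W \<in> \<A> \<and> M W = A))" for A
  have x_nonneg: "0 \<le> x A" for A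
    unfolding x_def by (intro subset_expectation_nonneg p) auto
  \<comment> \<open>For \<open>W \<in> \<A>\<close> the only nonzero summand is the one at
    \<open>M W\<close>. The identity is used at \<open>W\<close> and again at
    \<open>W \<union> A\<close>.\<close>
  have sum_M: "(\<Sum>A \<in> ?\<M>. of_bool (W \<in> \<A> \<and> M W = A)) = (of_bool (W \<in> \<A>) :: real)" for W
    using fin M\<A>(1)[of W] by (cases "W \<in> \<A>") (auto simp: of_bool_def)
  have sum_x: "(\<Sum>A \<in> ?\<M>. x A) = mu n p \<A>"
    unfolding x_def mu_eq_subset_expectation[OF p(1) sub]
    by (simp only: subset_expectation_sum[symmetric] sum_M)
  define r where "r = 1 / p - 1"
  have r: "r \<ge> 0" "r + 1 = 1 / p" using p by (auto simp: r_def)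
  define \<beta> where "\<beta> B = r ^ card B * (\<Sum>A' \<in> ?\<M>. x A' * of_bool (B \<subseteq> A'))" for B
  \<comment> \<open>Used twice: \<open>q = 1\<close> on a minterm gives the cover condition, and
    \<open>q = \<alpha> * p\<close> on \<open>{0..n}\<close> gives the weight.\<close>
  have sum_\<beta>: "(\<Sum>B \<in> Pow S. \<beta> B * q ^ card B) = (\<Sum>A' \<in> ?\<M>. x A' * (r * q + 1) ^ card (S \<inter> A'))"
    if "finite S" for S q
  proof -
    have "(\<Sum>B \<in> Pow S. (r * q) ^ card B * of_bool (B \<subseteq> A')) = (r * q + 1) ^ card (S \<inter> A')" for A'
    proof -
      have "(\<Sum>B \<in> Pow S. (r * q) ^ card B * of_bool (B \<subseteq> A')) =
          (\<Sum>B \<in> Pow (S \<inter> A'). (r * q) ^ card B)"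
        using that by (intro sum.mono_neutral_cong_right) auto
      also have "\<dots> = (r * q + 1) ^ card (S \<inter> A')"
        using that by (intro sum_Pow_power_card) simp
      finally show ?thesis .
    qed
    moreover have "(\<Sum>B \<in> Pow S. \<beta> B * q ^ card B) =
        (\<Sum>A' \<in> ?\<M>. x A' * (\<Sum>B \<in> Pow S. (r * q) ^ card B * of_bool (B \<subseteq> A')))"
      unfolding \<beta>_def sum_distrib_left sum_distrib_right
      by (subst sum.swap) (simp add: power_mult_distrib mult_ac)
    ultimately show ?thesis by simp
  qed
  have "1 \<le> (\<Sum>B \<in> Pow A. \<beta> B)" if A: "A \<in> ?\<M>" for A
  proof -
    have up_A: "W \<union> A \<in> \<A>" if "W \<subseteq> {0..n}" for W
      using up[of A "W \<union> A"] \<M>[OF A] that by auto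
    have "1 = ?E (\<lambda>W. of_bool (W \<union> A \<in> \<A>))"
      using up_A subset_expectation_cong[of "{0..n}" "\<lambda>W. of_bool (W \<union> A \<in> \<A>)" "\<lambda>_. 1"] by simp
    also have "\<dots> = (\<Sum>A' \<in> ?\<M>. ?E (\<lambda>W. of_bool (W \<union> A \<in> \<A> \<and> M (W \<union> A) = A')))"
      by (simp only: subset_expectation_sum[symmetric] sum_M)
    also have "\<dots> \<le> (\<Sum>A' \<in> ?\<M>. x A' * (1 / p) ^ card (A \<inter> A'))"
    proof (rule sum_mono)
      fix A' assume A': "A' \<in> ?\<M>"
      let ?C = "A \<inter> A'"
      have "?E (\<lambda>W. of_bool (W \<union> A \<in> \<A> \<and> M (W \<union> A) = A')) \<le>
          ?E (\<lambda>W. of_bool (W \<union> ?C \<in> \<A> \<and> M (W \<union> ?C) = A'))"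
      proof (rule subset_expectation_mono[OF p(1)])
        fix W assume W: "W \<subseteq> {0..n}"
        have "W \<union> ?C \<in> \<A> \<and> M (W \<union> ?C) = A'" if *: "W \<union> A \<in> \<A>" "M (W \<union> A) = A'"
        proof
          \<comment> \<open>Elements of \<open>A'\<close> outside \<open>A\<close> must come from
            \<open>W\<close>, and the others lie in \<open>?C\<close>. So \<open>A'\<close> survives
            the passage to the smaller set \<open>W \<union> ?C\<close>, and \<open>cons\<close>
            keeps it as the choice.\<close>
          have "A' \<subseteq> W \<union> ?C" using M\<A>(2)[OF *(1)] *(2) by auto
          then show "W \<union> ?C \<in> \<A>"
            using up[of A' "W \<union> ?C"] \<M>[OF A'] W by auto
          have "W \<union> ?C \<subseteq> W \<union> A" by auto
          then show "M (W \<union> ?C) = A'"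
            using cons A' *(2) \<open>A' \<subseteq> W \<union> ?C\<close> by blast
        qed
        then show "of_bool (W \<union> A \<in> \<A> \<and> M (W \<union> A) = A') \<le>
            (of_bool (W \<union> ?C \<in> \<A> \<and> M (W \<union> ?C) = A') :: real)"
          by auto
      qed
      \<comment> \<open>The event defining \<open>x A'\<close> forces
        \<open>A' \<subseteq> W\<close>, hence \<open>?C \<subseteq> W\<close>.\<close>
      moreover have "x A' = p ^ card ?C * ?E (\<lambda>W. of_bool (W \<union> ?C \<in> \<A> \<and> M (W \<union> ?C) = A'))"
        unfolding x_def using \<M>[OF A'] M\<A>(2) by (intro subset_expectation_union) auto
      ultimately show "?E (\<lambda>W. of_bool (W \<union> A \<in> \<A> \<and> M (W \<union> A) = A')) \<le>
          x A' * (1 / p) ^ card ?C"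
        using p(2) by (simp add: power_divide)
    qed
    also have "\<dots> = (\<Sum>B \<in> Pow A. \<beta> B)"
      using sum_\<beta>[OF \<M>(3)[OF A], of 1] r(2) by simp
    finally show ?thesis .
  qed
  moreover have "0 \<le> \<beta> B" for B
    unfolding \<beta>_def using r(1) x_nonneg by (intro mult_nonneg_nonneg sum_nonneg) auto
  ultimately have "\<beta> \<in> fractional_covers n \<A>"
    by (auto simp: fractional_covers_def)
  then have "frac_expectation n (\<alpha> * p) \<A> \<le> cover_weight n (\<alpha> * p) \<beta>"
    using sub assms(4) p by (intro frac_expectation_le_cover_weight) auto
  also have "\<dots> = (\<Sum>A' \<in> ?\<M>. x A' * (r * (\<alpha> * p) + 1) ^ card ({0..n} \<inter> A'))"
    unfolding cover_weight_def by (rule sum_\<beta>) simp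
  also have "\<dots> \<le> (\<Sum>A' \<in> ?\<M>. x A' * (1 + \<alpha>) ^ k)"
  proof (intro sum_mono mult_left_mono x_nonneg)
    fix A' assume A': "A' \<in> ?\<M>"
    \<comment> \<open>The base becomes \<open>1 + \<alpha> * (1 - p)\<close>, which is at most
      \<open>1 + \<alpha>\<close>; as \<open>1 + \<alpha>\<close> exceeds 1, the exponent can then
      be raised to \<open>k\<close>.\<close>
    have "r * (\<alpha> * p) = \<alpha> * (1 - p)" using p(2) by (simp add: r_def field_simps)
    moreover have "0 \<le> \<alpha> * (1 - p)" "\<alpha> * (1 - p) \<le> \<alpha>"
      using p assms(4) by (auto intro: mult_left_le)
    ultimately have "0 \<le> r * (\<alpha> * p) + 1" "r * (\<alpha> * p) + 1 \<le> 1 + \<alpha>"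
      by linarith+
    then have "(r * (\<alpha> * p) + 1) ^ card A' \<le> (1 + \<alpha>) ^ card A'"
      by (intro power_mono)
    also have "\<dots> \<le> (1 + \<alpha>) ^ k"
      using assms(2)[OF A'] assms(4) by (intro power_increasing) auto
    finally show "(r * (\<alpha> * p) + 1) ^ card ({0..n} \<inter> A') \<le> (1 + \<alpha>) ^ k"
      using \<M>(2)[OF A'] by (simp add: Int_absorb1)
  qed
  also have "\<dots> = (1 + \<alpha>) ^ k * mu n p \<A>"
    by (simp add: sum_x mult.commute flip: sum_distrib_right)
  finally show ?thesis .
qed

section \<open>The case \<open>p = 0\<close> and the conclusion\<close>

text \<open>The previous cover divides by \<open>p\<close>. At 0 nonempty sets cost nothing, so they
  all get value 1, while \<open>{}\<close> costs 1 per unit (\<open>0 ^ 0 = 1\<close>) and is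
  charged only if it lies in \<open>\<A>\<close>. The random set is almost surely empty, so this
  cost is \<open>mu n 0 \<A>\<close>.\<close>

lemma frac_expectation_0_le_mu_0:
  assumes "\<A> \<subseteq> Pow {0..n}"
  shows "frac_expectation n 0 \<A> \<le> mu n 0 \<A>"
proof -
  define \<beta> :: "nat set \<Rightarrow> real" where "\<beta> B = of_bool (B = {} \<longrightarrow> {} \<in> \<A>)" for B
  have "1 \<le> (\<Sum>B \<in> Pow A. \<beta> B)" if "A \<in> minterms \<A>" for A
  proof -
    have "A \<in> \<A>" "finite A"
      using that assms finite_subset[of A "{0..n}"] by (auto simp: minterms_def)
    have "1 = \<beta> A" using \<open>A \<in> \<A>\<close> by (auto simp: \<beta>_def)
    also have "\<dots> \<le> (\<Sum>B \<in> Pow A. \<beta> B)"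
      using \<open>finite A\<close> by (intro member_le_sum) (auto simp: \<beta>_def)
    finally show ?thesis .
  qed
  then have "\<beta> \<in> fractional_covers n \<A>"
    by (auto simp: fractional_covers_def \<beta>_def)
  then have "frac_expectation n 0 \<A> \<le> cover_weight n 0 \<beta>"
    using assms by (intro frac_expectation_le_cover_weight) auto
  also have "\<dots> = (\<Sum>B \<in> {{}}. \<beta> B * 0 ^ card B)"
    unfolding cover_weight_def
    by (intro sum.mono_neutral_right) (auto simp: card_eq_0_iff dest: finite_subset)
  also have "\<dots> = (\<Sum>W \<in> {{}}. 0 ^ card W * (1 - 0) ^ card ({0..n} - W) * of_bool (W \<in> \<A>))"
    by (simp add: \<beta>_def)
  also have "\<dots> = mu n 0 \<A>"
    unfolding mu_eq_subset_expectation[OF _ assms, of 0, simplified] subset_expectation_def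
    by (intro sum.mono_neutral_left) (auto simp: card_eq_0_iff dest: finite_subset)
  finally show ?thesis .
qed

theorem theorem2p4:
  fixes n k :: nat and \<A> :: "nat set set" and p \<alpha> :: real
  assumes "k \<ge> 1"
    and "monotone_family n \<A>"
    and "\<And>A. A \<in> minterms \<A> \<Longrightarrow> card A \<le> k"
    and "p \<in> {0..1}"
    and "\<alpha> > 0"
  shows "frac_expectation n p \<A> \<ge> mu n p \<A> \<and>
         mu n p \<A> \<ge> frac_expectation n (\<alpha> * p) \<A> * (1 + \<alpha>) powi (- int k)"
proof
  have sub: "\<A> \<subseteq> Pow {0..n}"
    using assms(2) by (simp add: monotone_family_def)
  then show "mu n p \<A> \<le> frac_expectation n p \<A>"
    using assms(4) by (rule mu_le_frac_expectation)
  have "frac_expectation n (\<alpha> * p) \<A> \<le> (1 + \<alpha>) ^ k * mu n p \<A>"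
  proof (cases "p = 0")
    case True
    \<comment> \<open>Here \<open>\<alpha> * p\<close> is 0 as well, and inserting a factor that is
      at least 1 only weakens the bound.\<close>
    have "1 * mu n p \<A> \<le> (1 + \<alpha>) ^ k * mu n p \<A>"
      using assms(5) by (intro mult_right_mono one_le_power) (auto simp: mu_def)
    then show ?thesis
      using frac_expectation_0_le_mu_0[OF sub] True by simp
  next
    case False
    then show ?thesis
      using assms by (intro frac_expectation_le_mu) auto
  qed
  then show "frac_expectation n (\<alpha> * p) \<A> * (1 + \<alpha>) powi (- int k) \<le> mu n p \<A>"
    using assms(5) by (simp add: power_int_minus field_simps)
qed

end
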